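(* For every sufficiently small $\gamma>0$ there exist $\alpha>0$ and $n_0$ such that the following holds for every $n\ge n_0$. Let $G$ be an $n$-vertex graph with independence number $\alpha(G)\le \alpha n$. Then for every $2$-edge-colouring of $G$ there is a weak monochromatic $K_3$-tiling $\Gamma$ in $G$ with \[ |\Gamma|\ge \begin{cases} 2\delta(G)-n-\gamma n, & \text{if }\tfrac12 n\le \delta(G)\le \tfrac35 n,\\[2mm] \delta(G)/3-\gamma n, & \text{if }\delta(G)>\tfrac35 n. \end{cases} \] Moreover, these bounds are asymptotically optimal.
   Context: A $K_3$-tiling in a graph $G$ is a family of vertex-disjoint triangles (copies of $K_3$) in $G$; its size $|\Gamma|$ is the number of triangles. In a $2$-edge-coloured graph, a weak monochromatic $K_3$-tiling is a $K_3$-tiling in which each individual triangle has all three of its edges of the same colour (different triangles may have different colours). $\delta(G)$ is the minimum degree and $\alpha(G)$ the independence number of $G$. The hypothesis "$1\gg\gamma\gg\alpha\gg1/n$" means $\gamma$ is sufficiently small, $\alpha$ sufficiently small in terms of $\gamma$, and $n$ sufficiently large in terms of $\alpha$. *)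

theory Defs
  imports Complex_Main
begin

definition simple_graph :: "'a set \<Rightarrow> 'a set set \<Rightarrow> bool" where
  "simple_graph V E \<longleftrightarrow> finite V \<and> (\<forall>e\<in>E. e \<subseteq> V \<and> card e = 2)"

definition degree :: "'a set \<Rightarrow> 'a set set \<Rightarrow> 'a \<Rightarrow> nat" where
  "degree V E v = card {u \<in> V. {v, u} \<in> E}"

(* Only meaningful for nonempty V. *)
definition min_degree :: "'a set \<Rightarrow> 'a set set \<Rightarrow> nat" where
  "min_degree V E = Min (degree V E ` V)"

(* In a simple graph {u, u} is never an edge, so u and v need not be required to be distinct. *)
definition independent_set :: "'a set \<Rightarrow> 'a set set \<Rightarrow> 'a set \<Rightarrow> bool" where
  "independent_set V E S \<longleftrightarrow> S \<subseteq> V \<and> (\<forall>u\<in>S. \<forall>v\<in>S. {u, v} \<notin> E)"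

definition independence_number :: "'a set \<Rightarrow> 'a set set \<Rightarrow> nat" where
  "independence_number V E = Max {card S |S. independent_set V E S}"

(* A triangle of a graph is identified with its set of three vertices. *)
definition triangle :: "'a set \<Rightarrow> 'a set set \<Rightarrow> 'a set \<Rightarrow> bool" where
  "triangle V E T \<longleftrightarrow>
     T \<subseteq> V \<and> card T = 3 \<and> (\<forall>u\<in>T. \<forall>v\<in>T. u \<noteq> v \<longrightarrow> {u, v} \<in> E)"

definition K3_tiling :: "'a set \<Rightarrow> 'a set set \<Rightarrow> 'a set set \<Rightarrow> bool" where
  "K3_tiling V E \<Gamma> \<longleftrightarrow> (\<forall>T\<in>\<Gamma>. triangle V E T) \<and> pairwise disjnt \<Gamma>"

(* A 2-edge-colouring is a map c into the two-element type bool; only its values on edges matter. *)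
definition monochromatic :: "('a set \<Rightarrow> bool) \<Rightarrow> 'a set \<Rightarrow> bool" where
  "monochromatic c T \<longleftrightarrow> (\<exists>k. \<forall>u\<in>T. \<forall>v\<in>T. u \<noteq> v \<longrightarrow> c {u, v} = k)"

definition weak_mono_K3_tiling ::
    "'a set \<Rightarrow> 'a set set \<Rightarrow> ('a set \<Rightarrow> bool) \<Rightarrow> 'a set set \<Rightarrow> bool" where
  "weak_mono_K3_tiling V E c \<Gamma> \<longleftrightarrow> K3_tiling V E \<Gamma> \<and> (\<forall>T\<in>\<Gamma>. monochromatic c T)"

end

theory Submission
  imports Defs
begin

text \<open>Lower bound: let \<open>U\<close> be the set of vertices missed by a maximum tiling \<open>\<Gamma>\<close>. If \<open>U\<close> spans few
  edges, counting the edges between \<open>U\<close> and the tiles gives \<open>\<delta> \<le> 3|\<Gamma>| + o(n)\<close>. Otherwise some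
  colour has many edges inside \<open>U\<close>. As the independence number is small, a vertex adjacent to both
  ends of a positive proportion of these edges lies in a monochromatic triangle with two vertices of
  \<open>U\<close>. No vertex of \<open>U\<close> is of this kind and each tile contains at most one such vertex, since two
  of them would allow trading the tile for two disjoint triangles. Hence the degrees of the two ends
  of an average edge of that colour in \<open>U\<close> sum to at most \<open>n + |\<Gamma>| + o(n)\<close>, that is,
  \<open>2\<delta> \<le> n + |\<Gamma>| + o(n)\<close>.

  Optimality: take one or two parts of size \<open>n - \<delta>\<close> spanning triangle-free graphs of small
  independence number and a clique on the rest, with all edges between different parts, and colour an
  edge by whether it crosses between parts. With one sparse part, monochromatic triangles lie in the
  clique; with two, they meet the clique. For the triangle-free graphs, join binary words of length
  \<open>3m\<close> at Hamming distance above \<open>2m\<close>.\<close>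

subsection \<open>Monochromatic triangles through a vertex\<close>

definition mono_triangle :: "'a set \<Rightarrow> 'a set set \<Rightarrow> ('a set \<Rightarrow> bool) \<Rightarrow> 'a set \<Rightarrow> bool" where
  "mono_triangle V E c T \<longleftrightarrow> triangle V E T \<and> monochromatic c T"

lemma weak_mono_K3_tiling_iff:
  "weak_mono_K3_tiling V E c \<Gamma> \<longleftrightarrow> (\<forall>T\<in>\<Gamma>. mono_triangle V E c T) \<and> pairwise disjnt \<Gamma>"
  unfolding weak_mono_K3_tiling_def K3_tiling_def mono_triangle_def by blast

lemma simple_graph_edge_subset: "simple_graph V E \<Longrightarrow> {x, y} \<in> E \<Longrightarrow> x \<in> V \<and> y \<in> V"
  unfolding simple_graph_def by blast

lemma simple_graph_edge_neq: "simple_graph V E \<Longrightarrow> {x, y} \<in> E \<Longrightarrow> x \<noteq> y"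
  unfolding simple_graph_def by fastforce

lemma mono_triangleI:
  assumes "simple_graph V E" "{x, y} \<in> E" "{x, z} \<in> E" "{y, z} \<in> E"
    and "c {x, y} = k" "c {x, z} = k" "c {y, z} = k"
  shows "mono_triangle V E c {x, y, z}"
proof -
  have "x \<noteq> y" "x \<noteq> z" "y \<noteq> z"
    using assms simple_graph_edge_neq by metis+
  then show ?thesis
    using assms simple_graph_edge_subset[OF assms(1)]
    unfolding mono_triangle_def triangle_def monochromatic_def
    by (auto simp: insert_commute)
qed

lemma finite_independent_cards:
  assumes "finite V"
  shows "finite {card S |S. independent_set V E S}"
proof -
  have "{card S |S. independent_set V E S} \<subseteq> card ` Pow V"
    unfolding independent_set_def by auto
  then show ?thesis
    using assms by (meson finite_Pow_iff finite_imageI finite_subset)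
qed

lemma maximum_independent_set:
  assumes "finite V"
  obtains S where "independent_set V E S" "card S = independence_number V E"
proof -
  have "independent_set V E {}" unfolding independent_set_def by simp
  then have "{card S |S. independent_set V E S} \<noteq> {}" by blast
  then show ?thesis
    using that Max_in[OF finite_independent_cards[OF assms], of E]
    unfolding independence_number_def by auto
qed

lemma edge_in_large_set:
  assumes "finite V" "S \<subseteq> V" "card S > independence_number V E"
  obtains u v where "u \<in> S" "v \<in> S" "{u, v} \<in> E"
proof (cases "independent_set V E S")
  case True
  then have "card S \<le> independence_number V E"
    unfolding independence_number_def by (intro Max_ge finite_independent_cards assms) auto
  then show ?thesis using assms(3) by simp
next
  case False
  then show ?thesis using that assms(2) unfolding independent_set_def by blast
qed

text \<open>Ordered pairs, so each edge counts twice: over both colours the cardinality is then the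
  sum over \<open>W\<close> of the degrees inside \<open>W\<close>.\<close>

definition coloured_pairs :: "'a set set \<Rightarrow> ('a set \<Rightarrow> bool) \<Rightarrow> bool \<Rightarrow> 'a set \<Rightarrow> ('a \<times> 'a) set" where
  "coloured_pairs E c k W = {(x, y) \<in> W \<times> W. {x, y} \<in> E \<and> c {x, y} = k}"

definition nbr_pairs ::
    "'a set set \<Rightarrow> ('a set \<Rightarrow> bool) \<Rightarrow> bool \<Rightarrow> 'a set \<Rightarrow> 'a \<Rightarrow> ('a \<times> 'a) set" where
  "nbr_pairs E c k W w = {(x, y) \<in> coloured_pairs E c k W. {w, x} \<in> E \<and> {w, y} \<in> E}"

lemma finite_coloured_pairs: "finite W \<Longrightarrow> finite (coloured_pairs E c k W)"
  unfolding coloured_pairs_def by (rule finite_subset[of _ "W \<times> W"]) auto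

lemma nbr_pairs_subset: "nbr_pairs E c k W w \<subseteq> coloured_pairs E c k W"
  unfolding nbr_pairs_def by auto

lemma finite_nbr_pairs: "finite W \<Longrightarrow> finite (nbr_pairs E c k W w)"
  using finite_subset[OF nbr_pairs_subset finite_coloured_pairs] .

text \<open>A \<open>k\<close>-coloured edge \<open>xy\<close> in the neighbourhood of \<open>w\<close> sends an edge of the other colour to \<open>w\<close>,
  say \<open>wx\<close>. For fixed \<open>y\<close>, an edge between two such vertices \<open>x\<close> would close a monochromatic
  triangle with \<open>y\<close> or with \<open>w\<close>, depending on its colour.\<close>

lemma card_nbr_pairs_le:
  assumes G: "simple_graph V E" and WV: "W \<subseteq> V"
    and noW: "\<And>T. mono_triangle V E c T \<Longrightarrow> \<not> T \<subseteq> W"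
    and now: "\<And>T. mono_triangle V E c T \<Longrightarrow> w \<in> T \<Longrightarrow> \<not> T \<subseteq> insert w W"
  shows "card (nbr_pairs E c k W w) \<le> 2 * independence_number V E * card W"
proof -
  let ?a = "independence_number V E"
  have finV: "finite V" using G unfolding simple_graph_def by blast
  have finW: "finite W" using WV finV by (rule finite_subset)
  define X where "X y = {x \<in> W. {x, y} \<in> E \<and> c {x, y} = k \<and> {w, x} \<in> E \<and> c {w, x} \<noteq> k}" for y
  have X_le: "card (X y) \<le> ?a" if y: "y \<in> W" for y
  proof (rule ccontr)
    assume "\<not> card (X y) \<le> ?a"
    moreover have "X y \<subseteq> V" using WV unfolding X_def by auto
    ultimately obtain u v where uv: "u \<in> X y" "v \<in> X y" "{u, v} \<in> E"
      using edge_in_large_set[OF finV] by (metis not_le)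
    show False
    proof (cases "c {u, v} = k")
      case True
      then have "mono_triangle V E c {u, v, y}"
        using uv unfolding X_def by (intro mono_triangleI[OF G, where k = k]) auto
      then show False using noW uv y unfolding X_def by blast
    next
      case False
      then have "mono_triangle V E c {w, u, v}"
        using uv unfolding X_def by (intro mono_triangleI[OF G, where k = "\<not> k"]) auto
      then show False using now uv unfolding X_def by blast
    qed
  qed
  define Z where "Z = (SIGMA y : W. X y)"
  have finX: "finite (X y)" for y using finW unfolding X_def by auto
  have "card Z = (\<Sum>y\<in>W. card (X y))"
    unfolding Z_def using finW finX by (intro card_SigmaI) auto
  also have "\<dots> \<le> (\<Sum>y\<in>W. ?a)" by (intro sum_mono X_le)
  finally have Z: "card Z \<le> ?a * card W" by (simp add: mult.commute)
  have finZ: "finite Z" unfolding Z_def using finW finX by auto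
  \<comment> \<open>A pair lies in \<open>Z\<close> if its second entry is joined to
    \<open>w\<close> in the other colour; the swapped copy takes the pairs whose first entry
    is.\<close>
  have "nbr_pairs E c k W w \<subseteq> Z \<union> prod.swap ` Z"
  proof clarify
    fix x y assume xy: "(x, y) \<in> nbr_pairs E c k W w" "(x, y) \<notin> prod.swap ` Z"
    have xy1: "x \<in> W" "y \<in> W" "{x, y} \<in> E" "c {x, y} = k" "{w, x} \<in> E" "{w, y} \<in> E"
      using xy(1) unfolding nbr_pairs_def coloured_pairs_def by auto
    have "(y, x) \<notin> Z" using xy(2) by force
    then have cx: "c {w, x} = k" using xy1 unfolding Z_def X_def by auto
    have "c {w, y} \<noteq> k"
    proof
      assume "c {w, y} = k"
      then have "mono_triangle V E c {w, x, y}"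
        using xy1 cx by (intro mono_triangleI[OF G, where k = k]) auto
      then show False using now xy1 by blast
    qed
    then show "(x, y) \<in> Z" using xy1 unfolding Z_def X_def by (auto simp: insert_commute)
  qed
  then have "card (nbr_pairs E c k W w) \<le> card (Z \<union> prod.swap ` Z)"
    using finZ by (intro card_mono) auto
  also have "\<dots> \<le> card Z + card (prod.swap ` Z)" by (rule card_Un_le)
  also have "\<dots> \<le> card Z + card Z" using card_image_le[OF finZ] by simp
  also have "\<dots> \<le> 2 * ?a * card W" using Z by simp
  finally show ?thesis .
qed

text \<open>The lost pairs have an end in \<open>T\<close>. This pays for finding a second triangle
  that avoids the vertices of a first one.\<close>

lemma card_nbr_pairs_Diff:
  assumes "finite W" "finite T"
  shows "card (nbr_pairs E c k W w) \<le> card (nbr_pairs E c k (W - T) w) + 2 * card T * card W"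
proof -
  have "nbr_pairs E c k W w \<subseteq> nbr_pairs E c k (W - T) w \<union> (T \<times> W \<union> W \<times> T)"
    unfolding nbr_pairs_def coloured_pairs_def by auto
  then have "card (nbr_pairs E c k W w) \<le> card (nbr_pairs E c k (W - T) w \<union> (T \<times> W \<union> W \<times> T))"
    using assms by (intro card_mono) (auto simp: finite_nbr_pairs)
  also have "\<dots> \<le> card (nbr_pairs E c k (W - T) w) + (card (T \<times> W) + card (W \<times> T))"
    by (meson add_left_mono card_Un_le le_trans)
  finally show ?thesis by (simp add: card_cartesian_product algebra_simps)
qed

subsection \<open>Maximum tilings\<close>

locale maximal_tiling =
  fixes V :: "'a set" and E c \<Gamma>
  assumes graph: "simple_graph V E"
    and tiling: "weak_mono_K3_tiling V E c \<Gamma>"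
    and maximal: "\<And>\<Gamma>'. weak_mono_K3_tiling V E c \<Gamma>' \<Longrightarrow> card \<Gamma>' \<le> card \<Gamma>"
begin

definition uncovered :: "'a set" where
  "uncovered = V - \<Union>\<Gamma>"

lemma finV: "finite V"
  using graph unfolding simple_graph_def by blast

lemma tile: "T \<in> \<Gamma> \<Longrightarrow> mono_triangle V E c T"
  using tiling unfolding weak_mono_K3_tiling_iff by blast

lemma tiles_disjoint: "S \<in> \<Gamma> \<Longrightarrow> T \<in> \<Gamma> \<Longrightarrow> S \<noteq> T \<Longrightarrow> S \<inter> T = {}"
  using tiling unfolding weak_mono_K3_tiling_iff pairwise_def disjnt_def by blast

lemma tile_subset: "T \<in> \<Gamma> \<Longrightarrow> T \<subseteq> V"
  using tile unfolding mono_triangle_def triangle_def by blast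

lemma mono_triangle_card: "mono_triangle V E c T \<Longrightarrow> card T = 3 \<and> finite T"
  unfolding mono_triangle_def triangle_def by (metis card.infinite zero_neq_numeral)

lemma fin\<Gamma>: "finite \<Gamma>"
  using tile_subset finV by (meson Pow_iff finite_Pow_iff finite_subset subsetI)

lemma uncovered_subset: "uncovered \<subseteq> V"
  unfolding uncovered_def by blast

lemma fin_uncovered: "finite uncovered"
  using finite_subset[OF uncovered_subset finV] .

lemma card_covered: "card (\<Union>\<Gamma>) \<le> 3 * card \<Gamma>"
proof -
  have "card (\<Union>\<Gamma>) \<le> (\<Sum>T\<in>\<Gamma>. card T)"
    by (rule card_Union_le_sum_card)
  also have "\<dots> = (\<Sum>T\<in>\<Gamma>. 3)" using tile mono_triangle_card by (intro sum.cong) auto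
  finally show ?thesis by simp
qed

lemma no_mono_triangle_uncovered:
  assumes "mono_triangle V E c T"
  shows "\<not> T \<subseteq> uncovered"
proof
  assume TU: "T \<subseteq> uncovered"
  have "T \<noteq> {}" using mono_triangle_card[OF assms] by auto
  then have "T \<notin> \<Gamma>" using TU unfolding uncovered_def by blast
  moreover have "weak_mono_K3_tiling V E c (insert T \<Gamma>)"
    using tiling assms TU
    unfolding weak_mono_K3_tiling_iff uncovered_def pairwise_insert disjnt_def by blast
  ultimately show False using maximal[of "insert T \<Gamma>"] fin\<Gamma> by simp
qed

text \<open>Replacing \<open>T\<close> by \<open>T1\<close> and \<open>T2\<close> would give a
  larger tiling. The triangles are disjoint because \<open>T2\<close> avoids the uncovered vertices
  of \<open>T1\<close>, and \<open>x\<close> and \<open>y\<close> are distinct covered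
  vertices.\<close>

lemma no_swap:
  assumes T: "T \<in> \<Gamma>" "x \<in> T" "y \<in> T" "x \<noteq> y"
    and T1: "mono_triangle V E c T1" "x \<in> T1" "T1 \<subseteq> insert x uncovered"
    and T2: "mono_triangle V E c T2" "y \<in> T2" "T2 \<subseteq> insert y (uncovered - T1)"
  shows False
proof -
  have yU: "y \<notin> uncovered" using T unfolding uncovered_def by blast
  have dis: "T1 \<inter> T2 = {}" using T T1 T2 yU by blast
  let ?D = "\<Gamma> - {T}"
  have away: "S \<inter> (T1 \<union> T2) = {}" if "S \<in> ?D" for S
    using that T T1 T2 tiles_disjoint[of S T] unfolding uncovered_def by blast
  have "T1 \<notin> ?D" "T2 \<notin> ?D" "T1 \<noteq> T2" using away T1 T2 dis by blast+
  then have "card (insert T1 (insert T2 ?D)) = Suc (card \<Gamma>)"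
    using fin\<Gamma> T(1) card_Suc_Diff1[OF fin\<Gamma> T(1)] by simp
  moreover have "weak_mono_K3_tiling V E c (insert T1 (insert T2 ?D))"
    unfolding weak_mono_K3_tiling_iff
  proof
    show "\<forall>S\<in>insert T1 (insert T2 ?D). mono_triangle V E c S" using tile T1(1) T2(1) by simp
    have "pairwise disjnt ?D"
      using tiling pairwise_subset unfolding weak_mono_K3_tiling_iff by blast
    then show "pairwise disjnt (insert T1 (insert T2 ?D))"
      using dis away unfolding pairwise_insert disjnt_def by blast
  qed
  ultimately show False using maximal by (metis not_less_eq_eq order_refl)
qed

text \<open>Call \<open>w\<close> heavy if it sees more than \<open>M\<close> pairs. Heavy vertices
  lie in tiles, at most one in each, and get the trivial bound; every other vertex contributes at
  most \<open>M\<close>.\<close>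

lemma sum_card_nbr_pairs_le:
  "(\<Sum>w\<in>V. card (nbr_pairs E c k uncovered w))
     \<le> card \<Gamma> * card (coloured_pairs E c k uncovered)
       + card V * ((2 * independence_number V E + 6) * card V)"
proof -
  let ?a = "independence_number V E" and ?U = uncovered
  let ?e = "card (coloured_pairs E c k ?U)"
  define f where "f w = card (nbr_pairs E c k ?U w)" for w
  \<comment> \<open>The first term is the bound of \<open>card_nbr_pairs_le\<close>; the 6 is twice
    the size of a triangle deleted from the uncovered set.\<close>
  define M where "M = (2 * ?a + 6) * card V"
  define H where "H = {w \<in> V. f w > M}"
  have U: "card ?U \<le> card V" using uncovered_subset finV by (rule card_mono[rotated])
  have aU: "2 * ?a * card W + 6 * card ?U \<le> M" if "W \<subseteq> ?U" for W
  proof -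
    have "card W \<le> card V" using that card_mono[OF fin_uncovered that] U by linarith
    then show ?thesis using U unfolding M_def add_mult_distrib by (intro add_mono mult_left_mono) auto
  qed
  \<comment> \<open>Used with \<open>T0\<close> empty for a first triangle, and with
    \<open>T0\<close> that triangle for a second one disjoint from it outside the covered
    set.\<close>
  have first: "\<exists>T. mono_triangle V E c T \<and> w \<in> T \<and> T \<subseteq> insert w (?U - T0)"
    if w: "w \<in> H" and T0: "finite T0" "card T0 \<le> 3" for w T0
  proof (rule ccontr)
    assume no: "\<not> ?thesis"
    have "card (nbr_pairs E c k (?U - T0) w) \<le> 2 * ?a * card (?U - T0)"
      using no no_mono_triangle_uncovered uncovered_subset by (intro card_nbr_pairs_le[OF graph]) blast+
    moreover have "2 * card T0 * card ?U \<le> 6 * card ?U" using T0 by simp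
    ultimately have "f w \<le> M"
      using card_nbr_pairs_Diff[OF fin_uncovered T0(1), of E c k w] aU[OF Diff_subset[of ?U T0]]
      unfolding f_def by linarith
    then show False using w unfolding H_def by simp
  qed
  have HU: "H \<subseteq> \<Union>\<Gamma>"
  proof
    fix w assume w: "w \<in> H"
    show "w \<in> \<Union>\<Gamma>"
    proof (rule ccontr)
      assume "w \<notin> \<Union>\<Gamma>"
      then have "w \<in> ?U" using w unfolding H_def uncovered_def by auto
      then show False using first[OF w, of "{}"] no_mono_triangle_uncovered by auto
    qed
  qed
  have HT: "card (H \<inter> T) \<le> 1" if T: "T \<in> \<Gamma>" for T
  proof -
    have "x = y" if xy: "x \<in> H \<inter> T" "y \<in> H \<inter> T" for x y
    proof (rule ccontr)
      assume ne: "x \<noteq> y"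
      obtain T1 where T1: "mono_triangle V E c T1" "x \<in> T1" "T1 \<subseteq> insert x ?U"
        using first[of x "{}"] xy by auto
      obtain T2 where T2: "mono_triangle V E c T2" "y \<in> T2" "T2 \<subseteq> insert y (?U - T1)"
        using first[of y T1] xy mono_triangle_card[OF T1(1)] by auto
      show False using no_swap[OF T _ _ ne T1 T2] xy by blast
    qed
    then show ?thesis
      using card_le_Suc0_iff_eq[of "H \<inter> T"] finV unfolding H_def by auto
  qed
  have "card H \<le> card \<Gamma>"
  proof -
    have "H = (\<Union>T\<in>\<Gamma>. H \<inter> T)" using HU by blast
    then have "card H \<le> (\<Sum>T\<in>\<Gamma>. card (H \<inter> T))"
      using card_UN_le[OF fin\<Gamma>, of "\<lambda>T. H \<inter> T"] by simp
    also have "\<dots> \<le> (\<Sum>T\<in>\<Gamma>. 1)" by (intro sum_mono HT)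
    finally show ?thesis by simp
  qed
  have fe: "f w \<le> ?e" for w
    unfolding f_def using fin_uncovered by (intro card_mono nbr_pairs_subset finite_coloured_pairs)
  have "(\<Sum>w\<in>V. f w) \<le> (\<Sum>w\<in>V. (if w \<in> H then ?e else 0) + M)"
    using fe by (intro sum_mono) (auto simp: H_def trans_le_add1)
  also have "\<dots> = card H * ?e + card V * M"
    using finV by (simp add: sum.distrib sum.If_cases H_def Int_def)
  also have "\<dots> \<le> card \<Gamma> * ?e + card V * M" using \<open>card H \<le> card \<Gamma>\<close> by simp
  finally show ?thesis unfolding f_def M_def .
qed

section \<open>Consequences of the minimum degree\<close>

lemma min_degree_le: "v \<in> V \<Longrightarrow> min_degree V E \<le> degree V E v"
  unfolding min_degree_def using finV by (intro Min_le) auto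

lemma degree_eq_sum: "degree V E v = (\<Sum>w\<in>V. of_bool ({w, v} \<in> E))"
  unfolding degree_def using finV by (simp add: insert_commute Int_def)

text \<open>Double counting of triples \<open>(x, y, w)\<close> with \<open>xy\<close> a \<open>k\<close>-coloured uncovered edge and \<open>w\<close> adjacent
  to \<open>x\<close> or \<open>y\<close>.\<close>

lemma dense_bound:
  "2 * min_degree V E * card (coloured_pairs E c k uncovered)
     \<le> (card V + card \<Gamma>) * card (coloured_pairs E c k uncovered)
       + card V * ((2 * independence_number V E + 6) * card V)"
proof -
  let ?P = "coloured_pairs E c k uncovered"
  have finP: "finite ?P" using finite_coloured_pairs[OF fin_uncovered] .
  have P: "fst p \<in> V" "snd p \<in> V" if "p \<in> ?P" for p
    using that uncovered_subset unfolding coloured_pairs_def by auto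
  have "2 * min_degree V E * card ?P = (\<Sum>p\<in>?P. 2 * min_degree V E)" by simp
  also have "\<dots> \<le> (\<Sum>p\<in>?P. degree V E (fst p) + degree V E (snd p))"
  proof (rule sum_mono)
    fix p assume "p \<in> ?P"
    from min_degree_le[OF P(1)[OF this]] min_degree_le[OF P(2)[OF this]]
    show "2 * min_degree V E \<le> degree V E (fst p) + degree V E (snd p)" by simp
  qed
  also have "\<dots> = (\<Sum>p\<in>?P. \<Sum>w\<in>V. of_bool ({w, fst p} \<in> E) + of_bool ({w, snd p} \<in> E))"
    by (simp only: degree_eq_sum sum.distrib)
  also have "\<dots> = (\<Sum>w\<in>V. \<Sum>p\<in>?P. of_bool ({w, fst p} \<in> E) + of_bool ({w, snd p} \<in> E))"
    by (rule sum.swap)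
  \<comment> \<open>For each pair, \<open>w\<close> contributes at most 1, and one more exactly when
    it is adjacent to both ends.\<close>
  also have "\<dots> \<le> (\<Sum>w\<in>V. card ?P + card (nbr_pairs E c k uncovered w))"
  proof (rule sum_mono)
    fix w
    have "nbr_pairs E c k uncovered w = {p \<in> ?P. {w, fst p} \<in> E \<and> {w, snd p} \<in> E}"
      unfolding nbr_pairs_def by auto
    then have "card (nbr_pairs E c k uncovered w)
        = (\<Sum>p\<in>?P. of_bool ({w, fst p} \<in> E \<and> {w, snd p} \<in> E))"
      using finP by (simp add: Int_def)
    moreover have "(\<Sum>p\<in>?P. of_bool ({w, fst p} \<in> E) + of_bool ({w, snd p} \<in> E))
        \<le> (\<Sum>p\<in>?P. 1 + of_bool ({w, fst p} \<in> E \<and> {w, snd p} \<in> E) :: nat)"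
      by (intro sum_mono) auto
    ultimately show "(\<Sum>p\<in>?P. of_bool ({w, fst p} \<in> E) + of_bool ({w, snd p} \<in> E))
        \<le> card ?P + card (nbr_pairs E c k uncovered w)"
      by (simp only: sum.distrib card_eq_sum)
  qed
  also have "\<dots> = card V * card ?P + (\<Sum>w\<in>V. card (nbr_pairs E c k uncovered w))"
    by (simp add: sum.distrib)
  finally show ?thesis using sum_card_nbr_pairs_le[of k] by (simp add: add_mult_distrib)
qed

text \<open>Sum the degrees over the uncovered vertices: each has at most 3|\<Gamma>| covered
  neighbours, and the remaining degrees sum to the number of coloured pairs.\<close>

lemma sparse_bound:
  "min_degree V E * card uncovered \<le> 3 * card \<Gamma> * card uncovered
     + (card (coloured_pairs E c True uncovered) + card (coloured_pairs E c False uncovered))"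
proof -
  let ?U = uncovered
  have deg: "degree V E v \<le> 3 * card \<Gamma> + card {u \<in> ?U. {v, u} \<in> E}" for v
  proof -
    have "{u \<in> V. {v, u} \<in> E} \<subseteq> \<Union>\<Gamma> \<union> {u \<in> ?U. {v, u} \<in> E}" unfolding uncovered_def by blast
    moreover have "finite (\<Union>\<Gamma>)" using tile_subset finV by (meson Sup_least finite_subset)
    ultimately have "degree V E v \<le> card (\<Union>\<Gamma> \<union> {u \<in> ?U. {v, u} \<in> E})"
      unfolding degree_def using fin_uncovered by (intro card_mono) auto
    then show ?thesis using card_Un_le card_covered by (meson add_le_mono1 le_trans)
  qed
  have "min_degree V E * card ?U = (\<Sum>v\<in>?U. min_degree V E)" by (simp add: mult.commute)
  also have "\<dots> \<le> (\<Sum>v\<in>?U. 3 * card \<Gamma> + card {u \<in> ?U. {v, u} \<in> E})"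
    using deg min_degree_le uncovered_subset by (intro sum_mono) (meson le_trans subsetD)
  also have "\<dots> = 3 * card \<Gamma> * card ?U + (\<Sum>v\<in>?U. card {u \<in> ?U. {v, u} \<in> E})"
    by (simp add: sum.distrib mult.commute)
  also have "(\<Sum>v\<in>?U. card {u \<in> ?U. {v, u} \<in> E}) = card (SIGMA v : ?U. {u \<in> ?U. {v, u} \<in> E})"
    using fin_uncovered by (intro card_SigmaI[symmetric]) auto
  also have "(SIGMA v : ?U. {u \<in> ?U. {v, u} \<in> E})
      = coloured_pairs E c True ?U \<union> coloured_pairs E c False ?U"
    unfolding coloured_pairs_def by auto
  also have "card \<dots> \<le> card (coloured_pairs E c True ?U) + card (coloured_pairs E c False ?U)"
    by (rule card_Un_le)
  finally show ?thesis by simp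
qed

lemma card_coloured_pairs_le: "card (coloured_pairs E c True uncovered) + card (coloured_pairs E c False uncovered)
    \<le> card uncovered * card uncovered"
proof -
  have "card (coloured_pairs E c True uncovered \<union> coloured_pairs E c False uncovered)
      \<le> card (uncovered \<times> uncovered)"
    using fin_uncovered by (intro card_mono) (auto simp: coloured_pairs_def)
  moreover have "coloured_pairs E c True uncovered \<inter> coloured_pairs E c False uncovered = {}"
    unfolding coloured_pairs_def by auto
  ultimately show ?thesis
    using card_Un_disjoint[OF finite_coloured_pairs finite_coloured_pairs] fin_uncovered
    by (metis card_cartesian_product)
qed

text \<open>The minimum encodes both regimes, as 2\<delta> - n \<le> \<delta>/3 exactly when
  \<delta> \<le> 3n/5.\<close>

lemma card_tiling_ge:
  fixes \<gamma> :: real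
  assumes \<gamma>: "\<gamma> > 0"
    and a: "real (independence_number V E) \<le> \<gamma> ^ 3 / 8 * real (card V)"
    and n: "real (card V) > 24 / \<gamma> ^ 3"
  shows "real (card \<Gamma>) \<ge> min (2 * real (min_degree V E) - real (card V)) (real (min_degree V E) / 3)
           - \<gamma> * real (card V)"
proof -
  define n t \<delta> u where "n = real (card V)" and "t = real (card \<Gamma>)"
    and "\<delta> = real (min_degree V E)" and "u = real (card uncovered)"
  define e where "e k = real (card (coloured_pairs E c k uncovered))" for k
  define a' where "a' = real (independence_number V E)"
  have n0: "n > 0" using n \<gamma> unfolding n_def by (smt (verit) divide_nonneg_pos zero_less_power)
  have sparse: "\<delta> * u \<le> 3 * t * u + (e True + e False)"
    using of_nat_mono[OF sparse_bound, where ?'a = real]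
    unfolding \<delta>_def u_def t_def e_def by simp
  have dense: "2 * \<delta> * e k \<le> (n + t) * e k + n * ((2 * a' + 6) * n)" for k
    using of_nat_mono[OF dense_bound[of k], where ?'a = real]
    unfolding \<delta>_def n_def t_def e_def a'_def by simp
  have eu: "e True + e False \<le> u * u"
    using of_nat_mono[OF card_coloured_pairs_le, where ?'a = real] unfolding e_def u_def by simp
  have u0: "u \<ge> 0" unfolding u_def by simp
  have "t \<ge> \<delta> / 3 - \<gamma> * n \<or> t \<ge> 2 * \<delta> - n - \<gamma> * n"
  \<comment> \<open>The later estimates divide by \<open>u\<close>. If nothing is uncovered, then 3t
    \<ge> n \<ge> \<delta>.\<close>
  proof (cases "u = 0")
    case True
    then have "uncovered = {}" using fin_uncovered unfolding u_def by simp
    then have "V \<subseteq> \<Union>\<Gamma>" unfolding uncovered_def by blast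
    then have "card V \<le> 3 * card \<Gamma>"
      using card_covered card_mono[of "\<Union>\<Gamma>" V] tile_subset finV
      by (metis Sup_least finite_subset le_trans)
    moreover have "min_degree V E \<le> card V"
    proof -
      have "V \<noteq> {}" using n0 unfolding n_def by auto
      then obtain v where v: "v \<in> V" by blast
      have "degree V E v \<le> card V" unfolding degree_def using finV by (intro card_mono) auto
      then show ?thesis using min_degree_le[OF v] by simp
    qed
    ultimately have "\<delta> \<le> 3 * t" unfolding \<delta>_def t_def by linarith
    then show ?thesis using mult_pos_pos[OF \<gamma> n0] by simp
  next
    case False
    then have upos: "u > 0" using u0 by simp
    show ?thesis
    \<comment> \<open>The threshold is average degree \<gamma>n inside the uncovered set. Beyond it,
      \<open>u\<close> itself exceeds \<gamma>n, so the majority colour has quadratically many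
      pairs.\<close>
    proof (cases "e True + e False \<le> \<gamma> * n * u")
      case True
      then have "\<delta> * u \<le> (3 * t + \<gamma> * n) * u" using sparse by (simp add: algebra_simps)
      then have "\<delta> \<le> 3 * t + \<gamma> * n" using upos by simp
      then show ?thesis using mult_pos_pos[OF \<gamma> n0] by simp
    next
      case False
      then have big: "\<gamma> * n * u < e True + e False" by simp
      then have "\<gamma> * n * u < u * u" using eu by linarith
      then have un: "\<gamma> * n < u" using upos by simp
      have "e True > \<gamma> * n * u / 2 \<or> e False > \<gamma> * n * u / 2" using big by linarith
      then obtain k where k: "e k > \<gamma> * n * u / 2" by blast
      have "\<gamma> * n * (\<gamma> * n) \<le> \<gamma> * n * u" using un \<gamma> n0 by (intro mult_left_mono) auto
      then have ek: "e k > (\<gamma> * n)\<^sup>2 / 2" using k by (simp add: power2_eq_square)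
      have "t \<ge> 2 * \<delta> - n - \<gamma> * n"
      proof (rule ccontr)
        assume "\<not> ?thesis"
        then have "2 * \<delta> - n - t > \<gamma> * n" by simp
        then have less: "\<gamma> * n * e k \<le> (2 * \<delta> - n - t) * e k"
          unfolding e_def by (intro mult_right_mono) auto
        have "\<gamma> * n * ((\<gamma> * n)\<^sup>2 / 2) < \<gamma> * n * e k"
          using ek \<gamma> n0 by (intro mult_strict_left_mono) auto
        also note less
        also have "(2 * \<delta> - n - t) * e k \<le> n * ((2 * a' + 6) * n)"
          using dense[of k] by (simp add: algebra_simps)
        finally have "\<gamma> * n * ((\<gamma> * n)\<^sup>2 / 2) < n * ((2 * a' + 6) * n)" .
        then have "(n * n) * (\<gamma> ^ 3 * n / 2) < (n * n) * (2 * a' + 6)"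
          by (simp add: power2_eq_square power3_eq_cube algebra_simps)
        \<comment> \<open>Here the constants 8 and 24 arise: with a' \<le> \<gamma>^3 n / 8 the
          right side is at most \<gamma>^3 n / 4 + 6, which forces \<gamma>^3 n < 24.\<close>
        then have "\<gamma> ^ 3 * n / 2 < 2 * a' + 6" using n0 by (simp del: times_divide_eq_right)
        moreover have "a' \<le> \<gamma> ^ 3 * n / 8" using a unfolding a'_def n_def by simp
        ultimately have "\<gamma> ^ 3 * n < 24" by linarith
        then show False using n \<gamma> unfolding n_def by (simp add: field_simps)
      qed
      then show ?thesis by simp
    qed
  qed
  then show ?thesis unfolding n_def t_def \<delta>_def by linarith
qed

end

lemma maximal_tiling_exists:
  assumes "simple_graph V E"
  obtains \<Gamma> where "maximal_tiling V E c \<Gamma>"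
proof -
  let ?P = "\<lambda>\<Gamma>. weak_mono_K3_tiling V E c \<Gamma>"
  have "?P {}" by (simp add: weak_mono_K3_tiling_iff)
  moreover have "card \<Gamma> \<le> card (Pow V)" if "?P \<Gamma>" for \<Gamma>
  proof (rule card_mono)
    show "finite (Pow V)" using assms unfolding simple_graph_def by simp
    show "\<Gamma> \<subseteq> Pow V"
      using that unfolding weak_mono_K3_tiling_iff mono_triangle_def triangle_def by blast
  qed
  ultimately obtain \<Gamma> where "?P \<Gamma>" "\<And>\<Gamma>'. ?P \<Gamma>' \<Longrightarrow> card \<Gamma>' \<le> card \<Gamma>"
    using ex_has_greatest_nat[of ?P "{}" card "Suc (card (Pow V))"] by (metis less_Suc_eq_le)
  then show ?thesis using that assms unfolding maximal_tiling_def by blast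
qed

subsection \<open>Triangle-free graphs with small independence number\<close>

fun hamming :: "bool list \<Rightarrow> bool list \<Rightarrow> nat" where
  "hamming (a # x) (b # y) = of_bool (a \<noteq> b) + hamming x y"
| "hamming _ _ = 0"

lemma hamming_commute: "hamming x y = hamming y x"
  by (induction x y rule: hamming.induct) auto

text \<open>Among three bits two agree, so each coordinate contributes at most 2. Hence three words
  of length 3m cannot be pairwise at distance above 2m.\<close>

lemma hamming_triangle_sum:
  "length x = n \<Longrightarrow> length y = n \<Longrightarrow> length z = n \<Longrightarrow>
     hamming x y + hamming y z + hamming x z \<le> 2 * n"
proof (induction n arbitrary: x y z)
  case (Suc n)
  then obtain a x' b y' d z' where "x = a # x'" "y = b # y'" "z = d # z'"
    by (metis length_Suc_conv)
  then show ?case using Suc.IH[of x' y' z'] Suc.prems by auto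
qed simp

lemma hamming_map_Not:
  "length x = length y \<Longrightarrow> hamming x (map Not y) + hamming x y = length x"
  by (induction x y rule: list_induct2) auto

text \<open>Expanding (2K - r)(2K - s) \<ge> 0 and using rs = pq \<le> K^2 gives r + s \<le> 5K/2 in
  place of 4K.\<close>

lemma sum4_le:
  fixes K :: real
  assumes "p \<le> K" "q \<le> K" "r \<le> 2 * K" "s \<le> 2 * K" "0 \<le> p" "0 \<le> q" "p * q = r * s" "0 < K"
  shows "2 * (p + q + r + s) \<le> 9 * K"
proof -
  have "p * q \<le> K * K" using assms by (intro mult_mono) auto
  moreover have "0 \<le> (2 * K - r) * (2 * K - s)" using assms by simp
  ultimately have "K * (2 * (r + s)) \<le> K * (5 * K)" using assms(7) by (simp add: algebra_simps)
  then have "2 * (r + s) \<le> 5 * K" using assms(8) by simp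
  then show ?thesis using assms by simp
qed

lemma card_lists_split:
  assumes "A \<subseteq> {x. length x = Suc n}"
  shows "card A = card {x. True # x \<in> A} + card {x. False # x \<in> A}"
    and "{x. b # x \<in> A} \<subseteq> {x. length x = n}"
proof -
  show *: "{x. b # x \<in> A} \<subseteq> {x. length x = n}" for b using assms by auto
  have fin: "finite {x :: bool list. length x = n}"
    using finite_lists_length_eq[of "UNIV :: bool set" n] by simp
  have "A = (Cons True) ` {x. True # x \<in> A} \<union> (Cons False) ` {x. False # x \<in> A}" (is "_ = ?B \<union> ?C")
  proof
    show "A \<subseteq> ?B \<union> ?C"
    proof
      fix x assume "x \<in> A"
      moreover then obtain b y where "x = b # y" using assms by (auto simp: length_Suc_conv)
      ultimately show "x \<in> ?B \<union> ?C" by (cases b) auto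
    qed
  qed auto
  moreover have "card (?B \<union> ?C) = card ?B + card ?C"
    using finite_subset[OF * fin] by (intro card_Un_disjoint) auto
  ultimately show "card A = card {x. True # x \<in> A} + card {x. False # x \<in> A}"
    by (simp add: card_image)
qed

text \<open>Splitting \<open>A\<close> and \<open>B\<close> by the first bit gives four products of cardinalities with
  \<open>p * q = r * s\<close>; only through this relation is the factor per coordinate as small as \<open>9/2\<close>. Complementing
  one copy of an independent set turns small diameter into separation, and \<open>(9/2)^3 / 2 < 64\<close> then
  makes its density decay.\<close>

lemma hamming_separated_card:
  assumes "A \<subseteq> {x. length x = n}" "B \<subseteq> {x. length x = n}"
    and "\<And>x y. x \<in> A \<Longrightarrow> y \<in> B \<Longrightarrow> D \<le> hamming x y"
  shows "real (card A) * real (card B) \<le> (9/2) ^ n * (1/2) ^ D"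
  using assms
proof (induction n arbitrary: A B D)
  case 0
  show ?case
  proof (cases "A = {} \<or> B = {}")
    case False
    then have "A = {[]}" "B = {[]}" using 0 by auto
    then show ?thesis using 0(3) by simp
  qed auto
next
  case (Suc n)
  let ?K = "(9/2) ^ n * (1/2) ^ D :: real"
  define a b where "a i = real (card {x. i # x \<in> A})" and "b i = real (card {x. i # x \<in> B})" for i
  note sA = card_lists_split[OF Suc.prems(1)] and sB = card_lists_split[OF Suc.prems(2)]
  have same: "a i * b i \<le> ?K" for i
    unfolding a_def b_def using Suc.prems(3) by (intro Suc.IH sA sB) force
  have diff: "a i * b j \<le> 2 * ?K" if "i \<noteq> j" for i j
  proof -
    \<comment> \<open>Differing first bits supply one unit of distance, so the tails need only
      \<open>D - 1\<close>, at the cost of a factor 2. For \<open>D = 0\<close> the truncated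
      subtraction loses nothing.\<close>
    have "a i * b j \<le> (9/2) ^ n * (1/2) ^ (D - 1)"
      unfolding a_def b_def
    proof (intro Suc.IH sA sB)
      fix x y assume "x \<in> {x. i # x \<in> A}" "y \<in> {x. j # x \<in> B}"
      then have "D \<le> hamming (i # x) (j # y)" using Suc.prems(3) by blast
      then show "D - 1 \<le> hamming x y" using that by simp
    qed
    also have "\<dots> \<le> 2 * ?K" by (cases D) auto
    finally show ?thesis .
  qed
  have "2 * (a True * b True + a False * b False + a True * b False + a False * b True) \<le> 9 * ?K"
    by (rule sum4_le) (auto simp: same diff, auto simp: a_def b_def)
  then show ?case using sA(1) sB(1) unfolding a_def b_def by (simp add: algebra_simps)
qed

lemma hamming_independent_card:
  assumes "A \<subseteq> {x. length x = 3 * m}"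
    and "\<And>x y. x \<in> A \<Longrightarrow> y \<in> A \<Longrightarrow> hamming x y \<le> 2 * m"
  shows "(real (card A))\<^sup>2 \<le> (3/4) ^ m * (2 ^ (3 * m))\<^sup>2"
proof -
  let ?B = "map Not ` A"
  have "inj (map Not)" by (simp add: inj_def inj_map_eq_map)
  then have cB: "card ?B = card A" by (intro card_image) (meson inj_on_subset subset_UNIV)
  have "real (card A) * real (card ?B) \<le> (9/2) ^ (3 * m) * (1/2) ^ m"
  proof (rule hamming_separated_card)
    fix x y assume x: "x \<in> A" and "y \<in> ?B"
    then obtain z where z: "z \<in> A" "y = map Not z" by blast
    have "length x = 3 * m" "length z = 3 * m" using assms(1) x z(1) by auto
    then show "m \<le> hamming x y"
      using hamming_map_Not[of x z] assms(2)[OF x z(1)] z(2) by simp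
  qed (use assms(1) in auto)
  also have "\<dots> = ((9/2) ^ 3 * (1/2)) ^ m" by (simp only: power_mult power_mult_distrib)
  \<comment> \<open>Numerically, 729/16 < 48. The factor 64 per step is the square of the number of
    words of length 3.\<close>
  also have "\<dots> \<le> (3/4 * 64) ^ m" by (intro power_mono) (simp_all add: power3_eq_cube)
  also have "\<dots> = (3/4) ^ m * 64 ^ m" by (rule power_mult_distrib)
  also have "(64 :: real) ^ m = (2 ^ (3 * m))\<^sup>2"
  proof -
    have "(2 ^ (3 * m))\<^sup>2 = (2 :: real) ^ (6 * m)" by (simp flip: power_mult)
    also have "\<dots> = (2 ^ 6) ^ m" by (rule power_mult)
    finally show ?thesis by simp
  qed
  finally show ?thesis using cB by (simp add: power2_eq_square)
qed

text \<open>One graph on all naturals serves every \<open>n\<close>: cut them into blocks of length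
  \<open>N\<close> and put a copy of the word graph on each. The summand \<open>N\<close> pays for
  an incomplete last block.\<close>

lemma triangle_free_small_independence:
  fixes \<epsilon> :: real
  assumes "\<epsilon> > 0"
  obtains adj :: "nat \<Rightarrow> nat \<Rightarrow> bool" and N :: nat
  where "\<And>x y. adj x y \<Longrightarrow> adj y x"
    and "\<And>x y z. adj x y \<Longrightarrow> adj y z \<Longrightarrow> adj x z \<Longrightarrow> False"
    and "\<And>n S. S \<subseteq> {..<n} \<Longrightarrow> (\<And>x y. x \<in> S \<Longrightarrow> y \<in> S \<Longrightarrow> \<not> adj x y)
            \<Longrightarrow> real (card S) \<le> \<epsilon> * real (n + N)"
proof -
  obtain m where m: "(3/4) ^ m < \<epsilon>\<^sup>2"
    using real_arch_pow_inv[of "\<epsilon>\<^sup>2" "3/4"] assms by auto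
  let ?L = "{x :: bool list. length x = 3 * m}"
  define N :: nat where "N = 2 ^ (3 * m)"
  have N: "N > 0" unfolding N_def by simp
  have L: "finite ?L" "card ?L = N"
    using finite_lists_length_eq[of "UNIV :: bool set" "3 * m"]
      card_lists_length_eq[of "UNIV :: bool set" "3 * m"] unfolding N_def by auto
  then obtain f where f: "bij_betw f {0..<N} ?L"
    using ex_bij_betw_nat_finite by blast
  define g where "g x = f (x mod N)" for x
  have gL: "length (g x) = 3 * m" for x
  proof -
    have "x mod N \<in> {0..<N}" using N by simp
    then have "f (x mod N) \<in> ?L" using f bij_betwE by blast
    then show ?thesis unfolding g_def by simp
  qed
  define adj where "adj x y \<longleftrightarrow> x div N = y div N \<and> hamming (g x) (g y) > 2 * m" for x y
  have block: "real (card (S \<inter> {x. x div N = q})) \<le> \<epsilon> * real N"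
    if S: "\<And>x y. x \<in> S \<Longrightarrow> y \<in> S \<Longrightarrow> \<not> adj x y" for S q
  proof -
    let ?S = "S \<inter> {x. x div N = q}"
    have "inj_on g ?S"
    proof (rule inj_onI)
      \<comment> \<open>Within one block the residue modulo \<open>N\<close>, hence the word,
        determines the number.\<close>
      fix x y assume xy: "x \<in> ?S" "y \<in> ?S" and "g x = g y"
      then have "x mod N = y mod N"
        using f N unfolding g_def bij_betw_def inj_on_def by simp
      moreover have "x div N = y div N" using xy by simp
      ultimately show "x = y" by (metis div_mult_mod_eq)
    qed
    then have "(real (card ?S))\<^sup>2 = (real (card (g ` ?S)))\<^sup>2" by (simp only: card_image)
    also have "\<dots> \<le> (3/4) ^ m * (2 ^ (3 * m))\<^sup>2"
    proof (rule hamming_independent_card)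
      show "g ` ?S \<subseteq> ?L" using gL by auto
      fix x y assume "x \<in> g ` ?S" "y \<in> g ` ?S"
      then show "hamming x y \<le> 2 * m" using S unfolding adj_def by fastforce
    qed
    also have "\<dots> \<le> \<epsilon>\<^sup>2 * (2 ^ (3 * m))\<^sup>2"
      using m by (intro mult_right_mono) auto
    also have "\<dots> = (\<epsilon> * real N)\<^sup>2"
      unfolding N_def of_nat_power of_nat_numeral by (rule power_mult_distrib[symmetric])
    finally have "(real (card ?S))\<^sup>2 \<le> (\<epsilon> * real N)\<^sup>2" .
    then show ?thesis using assms by (simp add: power2_le_iff_abs_le)
  qed
  show ?thesis
  proof (rule that[of adj N])
    show "adj y x" if "adj x y" for x y
      using that hamming_commute unfolding adj_def by metis
    show False if "adj x y" "adj y z" "adj x z" for x y z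
      using that hamming_triangle_sum[OF gL gL gL, of x y z] unfolding adj_def by linarith
    fix n S assume Sn: "S \<subseteq> {..<n}" and S: "\<And>x y. x \<in> S \<Longrightarrow> y \<in> S \<Longrightarrow> \<not> adj x y"
    have "S = (\<Union>q\<in>{..n div N}. S \<inter> {x. x div N = q})"
      using Sn by (fastforce intro: div_le_mono)
    then have "card S \<le> (\<Sum>q\<in>{..n div N}. card (S \<inter> {x. x div N = q}))"
      using card_UN_le[of "{..n div N}" "\<lambda>q. S \<inter> {x. x div N = q}"] by simp
    then have "real (card S) \<le> (\<Sum>q\<in>{..n div N}. real (card (S \<inter> {x. x div N = q})))"
      by (metis of_nat_mono of_nat_sum)
    also have "\<dots> \<le> (\<Sum>q\<in>{..n div N}. \<epsilon> * real N)" using S by (intro sum_mono block) auto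
    also have "\<dots> = \<epsilon> * real (n div N * N + N)" by (simp add: algebra_simps)
    also have "\<dots> \<le> \<epsilon> * real (n + N)" using assms by (intro mult_left_mono of_nat_mono) auto
    finally show "real (card S) \<le> \<epsilon> * real (n + N)" .
  qed
qed

subsection \<open>Extremal colourings\<close>

text \<open>Here \<open>k\<close> plays the role of n - \<delta> and \<open>r\<close> is the number
  of sparse layers, each an interval of length \<open>k\<close>; all numbers from
  \<open>r * k\<close> on form the clique.\<close>

locale layered_graph =
  fixes n k r :: nat and adj :: "nat \<Rightarrow> nat \<Rightarrow> bool"
  assumes k_pos: "0 < k" and r_pos: "0 < r" and rk: "r * k \<le> n"
    and adj_sym: "adj x y \<Longrightarrow> adj y x"
    and adj_triangle_free: "adj x y \<Longrightarrow> adj y z \<Longrightarrow> adj x z \<Longrightarrow> False"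
begin

definition layer :: "nat \<Rightarrow> nat" where
  "layer x = min r (x div k)"

text \<open>Vertex 0 is isolated inside its layer so that the minimum degree is exactly \<open>n - k\<close>. Layer \<open>r\<close> is
  the clique.\<close>

definition edges :: "nat set set" where
  "edges = {{x, y} |x y. x < n \<and> y < n \<and> x \<noteq> y \<and>
     (layer x = layer y \<and> layer x < r \<longrightarrow> adj x y \<and> 0 < x \<and> 0 < y)}"

definition crossing :: "nat set \<Rightarrow> bool" where
  "crossing e \<longleftrightarrow> (\<exists>x\<in>e. \<exists>y\<in>e. layer x \<noteq> layer y)"

lemma edge_iff: "{x, y} \<in> edges \<longleftrightarrow> x < n \<and> y < n \<and> x \<noteq> y \<and>
     (layer x = layer y \<and> layer x < r \<longrightarrow> adj x y \<and> 0 < x \<and> 0 < y)"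
proof
  assume "{x, y} \<in> edges"
  then obtain a b where ab: "{x, y} = {a, b}" "a < n" "b < n" "a \<noteq> b"
    "layer a = layer b \<and> layer a < r \<longrightarrow> adj a b \<and> 0 < a \<and> 0 < b"
    unfolding edges_def by blast
  from ab(1) have "x = a \<and> y = b \<or> x = b \<and> y = a" by (simp add: doubleton_eq_iff)
  then show "x < n \<and> y < n \<and> x \<noteq> y \<and>
     (layer x = layer y \<and> layer x < r \<longrightarrow> adj x y \<and> 0 < x \<and> 0 < y)"
    using ab(2-5) adj_sym by auto
qed (auto simp: edges_def)

lemma crossing_pair: "crossing {x, y} \<longleftrightarrow> layer x \<noteq> layer y"
  unfolding crossing_def by auto

lemma layer_le: "layer x \<le> r"
  unfolding layer_def by simp

lemma layer_eq_r_iff: "layer x = r \<longleftrightarrow> r * k \<le> x"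
  unfolding layer_def using less_eq_div_iff_mult_less_eq[OF k_pos, of r x] by auto

section \<open>Minimum degree and independence number of the layered graph\<close>

lemma simple: "simple_graph {..<n} edges"
  unfolding simple_graph_def edges_def by auto

text \<open>A vertex of a sparse layer can miss only its own interval of \<open>k\<close> numbers; a
  clique vertex misses only itself, and \<open>k\<close> is at least 1.\<close>

lemma degree_ge:
  assumes v: "v < n"
  shows "n - k \<le> degree {..<n} edges v"
proof (cases "layer v = r")
  case True
  have "{..<n} - {v} \<subseteq> {u \<in> {..<n}. {v, u} \<in> edges}"
    using v True layer_le unfolding edge_iff by auto
  then have "card ({..<n} - {v}) \<le> degree {..<n} edges v"
    unfolding degree_def by (intro card_mono) auto
  moreover have "card ({..<n} - {v}) = n - 1" using v by simp
  ultimately show ?thesis using k_pos by linarith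
next
  case False
  let ?I = "{v div k * k..<v div k * k + k}"
  have lv: "layer v = v div k" using False unfolding layer_def by auto
  have "u \<in> ?I" if "layer v = layer u" for u
  proof -
    have "v div k = u div k" using that False lv unfolding layer_def by auto
    then show ?thesis using k_pos div_times_less_eq_dividend[of u k] dividend_less_div_times[of k u]
      by (simp add: add.commute)
  qed
  then have "{..<n} - ?I \<subseteq> {u \<in> {..<n}. {v, u} \<in> edges}"
    using v unfolding edge_iff by blast
  then have "card ({..<n} - ?I) \<le> degree {..<n} edges v"
    unfolding degree_def by (intro card_mono) auto
  moreover have "card {..<n} - card ?I \<le> card ({..<n} - ?I)" by (rule diff_card_le_card_Diff) simp
  ultimately show ?thesis by simp
qed

lemma n_pos: "0 < n"
  using k_pos r_pos rk by (metis gr0I le_zero_eq mult_is_0 neq0_conv)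

lemma degree_zero: "degree {..<n} edges 0 = n - k"
proof -
  have l0: "layer 0 = 0" unfolding layer_def by simp
  have lu: "layer u = 0 \<longleftrightarrow> u < k" for u
    unfolding layer_def using k_pos r_pos by (auto simp: min_def div_eq_0_iff)
  have nbr: "{0, u} \<in> edges \<longleftrightarrow> u < n \<and> k \<le> u" for u
  proof (cases "u < k")
    case True
    then show ?thesis using lu[of u] l0 r_pos unfolding edge_iff by simp
  next
    case False
    then have "layer u \<noteq> 0" "u \<noteq> 0" using lu[of u] k_pos by auto
    then show ?thesis using False n_pos l0 unfolding edge_iff by simp
  qed
  have "{u \<in> {..<n}. {0, u} \<in> edges} = {k..<n}"
    unfolding nbr by auto
  then show ?thesis unfolding degree_def by simp
qed

lemma min_degree: "min_degree {..<n} edges = n - k"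
  unfolding min_degree_def
proof (rule Min_eqI)
  show "n - k \<in> degree {..<n} edges ` {..<n}"
    using degree_zero n_pos by (intro image_eqI[of _ _ 0]) auto
  show "finite (degree {..<n} edges ` {..<n})" by simp
  show "n - k \<le> m" if "m \<in> degree {..<n} edges ` {..<n}" for m
    using that degree_ge by blast
qed

text \<open>An independent set meeting the clique is a singleton. Any other, with vertex 0 removed,
  is independent for \<open>adj\<close>, since \<open>adj\<close> joins distinct positive vertices
  whatever their layers; the summand 1 restores vertex 0.\<close>

lemma independence_number_le:
  fixes b :: real
  assumes b: "0 \<le> b"
    and adj_b: "\<And>S. S \<subseteq> {..<n} \<Longrightarrow> (\<And>x y. x \<in> S \<Longrightarrow> y \<in> S \<Longrightarrow> \<not> adj x y) \<Longrightarrow> real (card S) \<le> b"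
  shows "real (independence_number {..<n} edges) \<le> b + 1"
proof -
  obtain S where S: "independent_set {..<n} edges S" "independence_number {..<n} edges = card S"
    using maximum_independent_set[of "{..<n}" edges] by (metis finite_lessThan)
  have Sn: "S \<subseteq> {..<n}" and noE: "\<And>x y. x \<in> S \<Longrightarrow> y \<in> S \<Longrightarrow> {x, y} \<notin> edges"
    using S(1) unfolding independent_set_def by auto
  show ?thesis
  proof (cases "\<exists>x\<in>S. layer x = r")
    case True
    then obtain x where x: "x \<in> S" "layer x = r" by blast
    have "y = x" if y: "y \<in> S" for y
    proof (rule ccontr)
      assume "y \<noteq> x"
      moreover have "x < n" "y < n" using Sn x(1) y by auto
      ultimately have "{x, y} \<in> edges" using x(2) unfolding edge_iff by simp
      then show False using noE x(1) y by blast
    qed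
    then have "S = {x}" using x(1) by blast
    then show ?thesis using S(2) b by simp
  next
    case False
    have "\<not> adj x y" if "x \<in> S - {0}" "y \<in> S - {0}" for x y
    proof
      assume a: "adj x y"
      \<comment> \<open>A loop would be a degenerate triangle of \<open>adj\<close>.\<close>
      have "x \<noteq> y" using a adj_triangle_free by blast
      moreover have "x < n" "y < n" "0 < x" "0 < y" using that Sn by auto
      ultimately have "{x, y} \<in> edges" using a unfolding edge_iff by simp
      then show False using noE[of x y] that by simp
    qed
    then have "real (card (S - {0})) \<le> b" using Sn by (intro adj_b) auto
    moreover have "card S \<le> card (S - {0}) + 1"
      using diff_card_le_card_Diff[of "{0}" S] by simp
    ultimately show ?thesis using S(2) by linarith
  qed
qed

text \<open>Crossing edges alone force three distinct layers. Without them the triangle stays in one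
  layer, which must be the clique as the others are triangle-free.\<close>

lemma mono_triangle_layers:
  assumes "mono_triangle {..<n} edges crossing T"
  shows "T \<subseteq> {r * k..<n} \<or> (\<exists>x\<in>T. \<exists>y\<in>T. \<exists>z\<in>T. layer x \<noteq> layer y \<and> layer y \<noteq> layer z \<and> layer x \<noteq> layer z)"
proof -
  have "card T = 3" using assms unfolding mono_triangle_def triangle_def by blast
  then obtain x y z where T: "T = {x, y, z}" and ne: "x \<noteq> y" "y \<noteq> z" "x \<noteq> z"
    by (auto simp: card_3_iff)
  have E: "{x, y} \<in> edges" "{y, z} \<in> edges" "{x, z} \<in> edges"
    using assms T ne unfolding mono_triangle_def triangle_def by auto
  obtain b where "\<forall>u\<in>T. \<forall>v\<in>T. u \<noteq> v \<longrightarrow> crossing {u, v} = b"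
    using assms unfolding mono_triangle_def monochromatic_def by blast
  then have b: "crossing {x, y} = b" "crossing {y, z} = b" "crossing {x, z} = b"
    using T ne by auto
  show ?thesis
  proof (cases b)
    case True
    then have "layer x \<noteq> layer y" "layer y \<noteq> layer z" "layer x \<noteq> layer z"
      using b crossing_pair by auto
    then show ?thesis unfolding T by blast
  next
    case False
    then have l: "layer x = layer y" "layer y = layer z" using b crossing_pair by auto
    have "\<not> layer x < r"
    proof
      assume "layer x < r"
      then have "adj x y" "adj y z" "adj x z" using E l unfolding edge_iff by simp_all
      then show False by (rule adj_triangle_free)
    qed
    then have "layer x = r" using layer_le[of x] by simp
    then show ?thesis using E l unfolding T edge_iff by (auto simp: layer_eq_r_iff[symmetric])
  qed
qed

text \<open>Disjoint tiles use disjoint sets of at least \<open>q\<close> clique vertices.\<close>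

lemma card_tiling_le:
  assumes tiling: "weak_mono_K3_tiling {..<n} edges crossing \<Gamma>"
    and q: "\<And>T. mono_triangle {..<n} edges crossing T \<Longrightarrow> q \<le> card (T \<inter> {r * k..<n})"
  shows "q * card \<Gamma> \<le> n - r * k"
proof -
  let ?B = "{r * k..<n}"
  have mono: "\<And>T. T \<in> \<Gamma> \<Longrightarrow> mono_triangle {..<n} edges crossing T" and dis: "pairwise disjnt \<Gamma>"
    using tiling unfolding weak_mono_K3_tiling_iff by auto
  have "\<Gamma> \<subseteq> Pow {..<n}" using mono unfolding mono_triangle_def triangle_def by blast
  then have fin: "finite \<Gamma>" using finite_subset by blast
  have "q * card \<Gamma> = (\<Sum>T\<in>\<Gamma>. q)" by simp
  also have "\<dots> \<le> (\<Sum>T\<in>\<Gamma>. card (T \<inter> ?B))" using q mono by (intro sum_mono) auto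
  also have "\<dots> = card (\<Union>T\<in>\<Gamma>. T \<inter> ?B)"
    using fin dis unfolding pairwise_def disjnt_def by (intro card_UN_disjoint[symmetric]) auto
  also have "\<dots> \<le> card ?B" by (intro card_mono) auto
  finally show ?thesis by simp
qed

lemma card_tiling_le_one_sparse_layer:
  assumes "r = 1" "weak_mono_K3_tiling {..<n} edges crossing \<Gamma>"
  shows "3 * card \<Gamma> \<le> n - k"
proof -
  have "3 \<le> card (T \<inter> {r * k..<n})" if T: "mono_triangle {..<n} edges crossing T" for T
  proof -
    \<comment> \<open>Only layers 0 and 1 exist, so every monochromatic triangle lies in the
      clique.\<close>
    have "\<not> (layer x \<noteq> layer y \<and> layer y \<noteq> layer z \<and> layer x \<noteq> layer z)" for x y z
      using layer_le[of x] layer_le[of y] layer_le[of z] assms(1) by linarith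
    then have "T \<inter> {r * k..<n} = T" using mono_triangle_layers[OF T] by blast
    then show ?thesis using T unfolding mono_triangle_def triangle_def by simp
  qed
  then show ?thesis using card_tiling_le[OF assms(2), of 3] assms(1) by simp
qed

lemma card_tiling_le_two_sparse_layers:
  assumes "r = 2" "weak_mono_K3_tiling {..<n} edges crossing \<Gamma>"
  shows "card \<Gamma> \<le> n - 2 * k"
proof -
  have "1 \<le> card (T \<inter> {r * k..<n})" if T: "mono_triangle {..<n} edges crossing T" for T
  proof -
    have Tn: "T \<subseteq> {..<n}" "T \<noteq> {}" using T unfolding mono_triangle_def triangle_def by auto
    \<comment> \<open>The only layers are 0, 1 and 2, so three distinct ones include the
      clique.\<close>
    have top: "layer x = r \<or> layer y = r \<or> layer z = r"
      if "layer x \<noteq> layer y \<and> layer y \<noteq> layer z \<and> layer x \<noteq> layer z" for x y z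
      using layer_le[of x] layer_le[of y] layer_le[of z] assms(1) that by linarith
    from mono_triangle_layers[OF T] have "\<exists>x\<in>T. r * k \<le> x"
    proof
      assume "T \<subseteq> {r * k..<n}"
      then show ?thesis using Tn by auto
    next
      assume "\<exists>x\<in>T. \<exists>y\<in>T. \<exists>z\<in>T. layer x \<noteq> layer y \<and> layer y \<noteq> layer z \<and> layer x \<noteq> layer z"
      then obtain x y z where "x \<in> T" "y \<in> T" "z \<in> T"
        "layer x = r \<or> layer y = r \<or> layer z = r"
        using top by blast
      then show ?thesis unfolding layer_eq_r_iff by auto
    qed
    then obtain x where "x \<in> T" "r * k \<le> x" by blast
    then have "x \<in> T \<inter> {r * k..<n}" using Tn(1) by auto
    then have "T \<inter> {r * k..<n} \<noteq> {}" by blast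
    then show ?thesis by (simp add: Suc_le_eq card_gt_0_iff)
  qed
  then show ?thesis using card_tiling_le[OF assms(2), of 1] assms(1) by simp
qed

end

subsection \<open>The tiling theorem\<close>

theorem theorem1p3:
  "(\<exists>\<gamma>0>0::real. \<forall>\<gamma>::real. 0 < \<gamma> \<and> \<gamma> < \<gamma>0 \<longrightarrow>
      (\<exists>\<alpha>>0::real. \<exists>n0::nat. \<forall>n\<ge>n0. \<forall>(V::nat set) E.
         simple_graph V E \<and> card V = n \<and> real (independence_number V E) \<le> \<alpha> * real n \<longrightarrow>
         (\<forall>c::nat set \<Rightarrow> bool. \<exists>\<Gamma>. weak_mono_K3_tiling V E c \<Gamma> \<and>
            (1/2 * real n \<le> real (min_degree V E) \<and> real (min_degree V E) \<le> 3/5 * real n \<longrightarrow>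
               real (card \<Gamma>) \<ge> 2 * real (min_degree V E) - real n - \<gamma> * real n) \<and>
            (real (min_degree V E) > 3/5 * real n \<longrightarrow>
               real (card \<Gamma>) \<ge> real (min_degree V E) / 3 - \<gamma> * real n))))
   \<and>
   (\<forall>\<gamma>>0::real. \<forall>\<alpha>>0::real. \<exists>n0::nat. \<forall>n\<ge>n0. \<forall>d::nat.
      1/2 * real n \<le> real d \<and> d < n \<longrightarrow>
      (\<exists>(V::nat set) E. simple_graph V E \<and> card V = n \<and>
         real (independence_number V E) \<le> \<alpha> * real n \<and> min_degree V E = d \<and>
         (\<exists>c::nat set \<Rightarrow> bool. \<forall>\<Gamma>. weak_mono_K3_tiling V E c \<Gamma> \<longrightarrow>
            (real d \<le> 3/5 * real n \<longrightarrow>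
               real (card \<Gamma>) \<le> 2 * real d - real n + \<gamma> * real n) \<and>
            (real d > 3/5 * real n \<longrightarrow>
               real (card \<Gamma>) \<le> real d / 3 + \<gamma> * real n))))"
proof (intro conjI allI impI)
  show "\<exists>\<gamma>0>0::real. \<forall>\<gamma>::real. 0 < \<gamma> \<and> \<gamma> < \<gamma>0 \<longrightarrow>
      (\<exists>\<alpha>>0::real. \<exists>n0::nat. \<forall>n\<ge>n0. \<forall>(V::nat set) E.
         simple_graph V E \<and> card V = n \<and> real (independence_number V E) \<le> \<alpha> * real n \<longrightarrow>
         (\<forall>c::nat set \<Rightarrow> bool. \<exists>\<Gamma>. weak_mono_K3_tiling V E c \<Gamma> \<and>
            (1/2 * real n \<le> real (min_degree V E) \<and> real (min_degree V E) \<le> 3/5 * real n \<longrightarrow>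
               real (card \<Gamma>) \<ge> 2 * real (min_degree V E) - real n - \<gamma> * real n) \<and>
            (real (min_degree V E) > 3/5 * real n \<longrightarrow>
               real (card \<Gamma>) \<ge> real (min_degree V E) / 3 - \<gamma> * real n)))"
  proof (rule exI[of _ 1], intro conjI allI impI)
    fix \<gamma> :: real assume "0 < \<gamma> \<and> \<gamma> < 1"
    then have \<gamma>: "\<gamma> > 0" by simp
    obtain n0 where n0: "real n0 > 24 / \<gamma> ^ 3" using reals_Archimedean2 by blast
    have bound: "\<exists>\<Gamma>. weak_mono_K3_tiling V E c \<Gamma> \<and>
            (1/2 * real n \<le> real (min_degree V E) \<and> real (min_degree V E) \<le> 3/5 * real n \<longrightarrow>
               real (card \<Gamma>) \<ge> 2 * real (min_degree V E) - real n - \<gamma> * real n) \<and>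
            (real (min_degree V E) > 3/5 * real n \<longrightarrow>
               real (card \<Gamma>) \<ge> real (min_degree V E) / 3 - \<gamma> * real n)"
      if n: "n \<ge> n0" and G: "simple_graph V E" and card: "card V = n"
        and a: "real (independence_number V E) \<le> \<gamma> ^ 3 / 8 * real n"
      for n and V :: "nat set" and E and c :: "nat set \<Rightarrow> bool"
    proof -
      obtain \<Gamma> where "maximal_tiling V E c \<Gamma>" using maximal_tiling_exists[OF G] by blast
      then interpret maximal_tiling V E c \<Gamma> .
      have "real (card V) > 24 / \<gamma> ^ 3" using n0 n card by linarith
      then have "real (card \<Gamma>) \<ge> min (2 * real (min_degree V E) - real n) (real (min_degree V E) / 3)
           - \<gamma> * real n"
        using card_tiling_ge[OF \<gamma>] a card by simp
      then show ?thesis using tiling by (intro exI[of _ \<Gamma>]) auto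
    qed
    show "\<exists>\<alpha>>0::real. \<exists>n0::nat. \<forall>n\<ge>n0. \<forall>(V::nat set) E.
         simple_graph V E \<and> card V = n \<and> real (independence_number V E) \<le> \<alpha> * real n \<longrightarrow>
         (\<forall>c::nat set \<Rightarrow> bool. \<exists>\<Gamma>. weak_mono_K3_tiling V E c \<Gamma> \<and>
            (1/2 * real n \<le> real (min_degree V E) \<and> real (min_degree V E) \<le> 3/5 * real n \<longrightarrow>
               real (card \<Gamma>) \<ge> 2 * real (min_degree V E) - real n - \<gamma> * real n) \<and>
            (real (min_degree V E) > 3/5 * real n \<longrightarrow>
               real (card \<Gamma>) \<ge> real (min_degree V E) / 3 - \<gamma> * real n))"
      using \<gamma> bound by (intro exI[of _ "\<gamma> ^ 3 / 8"] exI[of _ n0] conjI) auto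
  qed simp
next
  fix \<gamma> \<alpha> :: real assume \<gamma>: "\<gamma> > 0" and \<alpha>: "\<alpha> > 0"
  then obtain adj N where sym: "\<And>x y. adj x y \<Longrightarrow> adj y x"
    and tri: "\<And>x y z. adj x y \<Longrightarrow> adj y z \<Longrightarrow> adj x z \<Longrightarrow> False"
    and ind: "\<And>n S. S \<subseteq> {..<n} \<Longrightarrow> (\<And>x y. x \<in> S \<Longrightarrow> y \<in> S \<Longrightarrow> \<not> adj x y)
            \<Longrightarrow> real (card S) \<le> \<alpha> / 2 * real (n + N)"
    using triangle_free_small_independence[of "\<alpha> / 2"] by (metis half_gt_zero)
  \<comment> \<open>Chosen so that half of \<alpha>n absorbs both the summand \<open>N\<close> and
    the extra vertex 0.\<close>
  obtain n0 where n0: "real n0 > (\<alpha> / 2 * real N + 1) / (\<alpha> / 2)" using reals_Archimedean2 by blast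
  show "\<exists>n0::nat. \<forall>n\<ge>n0. \<forall>d::nat.
      1/2 * real n \<le> real d \<and> d < n \<longrightarrow>
      (\<exists>(V::nat set) E. simple_graph V E \<and> card V = n \<and>
         real (independence_number V E) \<le> \<alpha> * real n \<and> min_degree V E = d \<and>
         (\<exists>c::nat set \<Rightarrow> bool. \<forall>\<Gamma>. weak_mono_K3_tiling V E c \<Gamma> \<longrightarrow>
            (real d \<le> 3/5 * real n \<longrightarrow>
               real (card \<Gamma>) \<le> 2 * real d - real n + \<gamma> * real n) \<and>
            (real d > 3/5 * real n \<longrightarrow>
               real (card \<Gamma>) \<le> real d / 3 + \<gamma> * real n)))"
  proof (rule exI[of _ n0], intro allI impI)
    fix n d assume n: "n \<ge> n0" and d: "1/2 * real n \<le> real d \<and> d < n"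
    \<comment> \<open>Two sparse layers allow 2d - n tiles and one allows d/3; the smaller of these
      switches at d = 3n/5.\<close>
    define r :: nat where "r = (if real d \<le> 3/5 * real n then 2 else 1)"
    interpret layered_graph n "n - d" r adj
    proof
      show "0 < n - d" "0 < r" using d unfolding r_def by auto
      \<comment> \<open>This makes room for two sparse layers of size n - d.\<close>
      have "n \<le> 2 * d" using d by linarith
      then show "r * (n - d) \<le> n" unfolding r_def by auto
    qed (fact sym, fact tri)
    have "(\<alpha> / 2 * real N + 1) / (\<alpha> / 2) < real n" using n0 n by linarith
    then have "\<alpha> / 2 * real N + 1 < real n * (\<alpha> / 2)" using \<alpha> by (simp add: divide_less_eq)
    moreover have "\<alpha> / 2 * real (n + N) = real n * (\<alpha> / 2) + \<alpha> / 2 * real N"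
      by (simp add: distrib_left)
    moreover have "real n * (\<alpha> / 2) + real n * (\<alpha> / 2) = \<alpha> * real n" by simp
    ultimately have "\<alpha> / 2 * real (n + N) + 1 \<le> \<alpha> * real n" by linarith
    moreover have "real (independence_number {..<n} edges) \<le> \<alpha> / 2 * real (n + N) + 1"
      using \<alpha> ind by (intro independence_number_le) auto
    ultimately have "real (independence_number {..<n} edges) \<le> \<alpha> * real n" by linarith
    moreover have "min_degree {..<n} edges = d" using min_degree d by simp
    moreover have "(real d \<le> 3/5 * real n \<longrightarrow>
               real (card \<Gamma>) \<le> 2 * real d - real n + \<gamma> * real n) \<and>
            (real d > 3/5 * real n \<longrightarrow> real (card \<Gamma>) \<le> real d / 3 + \<gamma> * real n)"
      if \<Gamma>: "weak_mono_K3_tiling {..<n} edges crossing \<Gamma>" for \<Gamma>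
    proof -
      have g: "\<gamma> * real n \<ge> 0" using \<gamma> by simp
      show ?thesis
      proof (cases "real d \<le> 3/5 * real n")
        case True
        then have "r = 2" unfolding r_def by simp
        then have "card \<Gamma> \<le> n - 2 * (n - d)"
          using card_tiling_le_two_sparse_layers \<Gamma> by blast
        then have "card \<Gamma> + n \<le> 2 * d" using d by linarith
        then show ?thesis using True g by linarith
      next
        case False
        then have "r = 1" unfolding r_def by simp
        then have "3 * card \<Gamma> \<le> n - (n - d)"
          using card_tiling_le_one_sparse_layer \<Gamma> by blast
        then have "3 * card \<Gamma> \<le> d" using d by simp
        then show ?thesis using False g by linarith
      qed
    qed
    ultimately show "\<exists>(V::nat set) E. simple_graph V E \<and> card V = n \<and>
         real (independence_number V E) \<le> \<alpha> * real n \<and> min_degree V E = d \<and>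
         (\<exists>c::nat set \<Rightarrow> bool. \<forall>\<Gamma>. weak_mono_K3_tiling V E c \<Gamma> \<longrightarrow>
            (real d \<le> 3/5 * real n \<longrightarrow>
               real (card \<Gamma>) \<le> 2 * real d - real n + \<gamma> * real n) \<and>
            (real d > 3/5 * real n \<longrightarrow>
               real (card \<Gamma>) \<le> real d / 3 + \<gamma> * real n))"
      using simple by (intro exI[of _ "{..<n}"] exI[of _ edges] conjI exI[of _ crossing]) auto
  qed
qed

end
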